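(* Let $w\in\widetilde{A}_{n-1}$ be a fully commutative element. Then $w$ is an involution if and only if $\mathrm{Heap}(w)$ is a self-dual alternating heap of type $\widetilde{A}_{n-1}$.
   Context: $n\ge3$. $\widetilde A_{n-1}$ is the Coxeter group with generators $s_0,\dots,s_{n-1}$ whose Coxeter graph is the cycle $s_0-s_1-\cdots-s_{n-1}-s_0$ with all edges labelled $3$ (indices mod $n$). An element $w$ is fully commutative (FC) if any reduced expression of $w$ can be obtained from any other one using only commutation relations between commuting generators. An involution is an element with $w^2=1$ (identity included). A heap on a finite graph $\Gamma$ with vertex set $S$ is a finite poset $(H,\le)$ with a labeling map $\epsilon:H\to S$ such that: (1) for any vertex $s$ and any edge $\{s,t\}$, the subposets $H_s=\epsilon^{-1}(\{s\})$ and $H_{\{s,t\}}=\epsilon^{-1}(\{s,t\})$ are totally ordered; (2) $\le$ is the transitive closure of the relations given by all chains $H_s$ and $H_{\{s,t\}}$. Heaps are isomorphic if there is a label-preserving poset isomorphism between them. The dual of $(H,\le,\epsilon)$ is $(H,\ge,\epsilon)$; a heap is self-dual if it is isomorphic to its dual. For a word $\mathbf w=s_{a_1}\cdots s_{a_l}$ in the generators, $\mathrm{Heap}(\mathbf w)$ is the poset on $\{1,\dots,l\}$ obtained as the transitive closure of: $i\prec j$ if $i<j$ and either $s_{a_i}=s_{a_j}$ or $\{s_{a_i},s_{a_j}\}$ is an edge of $\Gamma$, with labels $\epsilon(i)=s_{a_i}$. For $w$ FC, $\mathrm{Heap}(w):=\mathrm{Heap}(\mathbf w)$ for any reduced word $\mathbf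 w$ of $w$; its isomorphism class does not depend on $\mathbf w$. A heap of type $\widetilde A_{n-1}$ (that is, a heap on the cycle graph $s_0-s_1-\cdots-s_{n-1}-s_0$) is alternating if for each edge $\{s_i,s_{i+1}\}$ (with $s_n=s_0$) the labels along the chain $H_{\{s_i,s_{i+1}\}}$ alternate between $s_i$ and $s_{i+1}$. *)

theory Defs
  imports "HOL-Algebra.Group"
begin

section \<open>Coxeter groups\<close>

text \<open>
  A Coxeter system is given by a set \<open>S\<close> of generators and a symmetric matrix \<open>m\<close> with
  \<open>m s s = 1\<close> and \<open>m s t \<noteq> 1\<close> for \<open>s \<noteq> t\<close>; the entry \<open>0\<close> encodes \<open>\<infinity>\<close>.  The group is
  \<open>\<langle>S | (s t)^(m s t) = 1\<rangle>\<close>, realised as words over \<open>S\<close> modulo the congruence generated by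
  the relators.  As \<open>m s s = 1\<close>, the relators include \<open>s s = 1\<close>, so no formal inverses are
  needed.
\<close>

inductive cox_equiv :: "'a set \<Rightarrow> ('a \<Rightarrow> 'a \<Rightarrow> nat) \<Rightarrow> 'a list \<Rightarrow> 'a list \<Rightarrow> bool"
  for S :: "'a set" and m :: "'a \<Rightarrow> 'a \<Rightarrow> nat" where
  refl: "u \<in> lists S \<Longrightarrow> cox_equiv S m u u"
| sym: "cox_equiv S m u v \<Longrightarrow> cox_equiv S m v u"
| trans: "cox_equiv S m u v \<Longrightarrow> cox_equiv S m v w \<Longrightarrow> cox_equiv S m u w"
| relator: "\<lbrakk>u \<in> lists S; v \<in> lists S; s \<in> S; t \<in> S\<rbrakk>
    \<Longrightarrow> cox_equiv S m (u @ concat (replicate (m s t) [s, t]) @ v) (u @ v)"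

definition cox_elt :: "'a set \<Rightarrow> ('a \<Rightarrow> 'a \<Rightarrow> nat) \<Rightarrow> 'a list \<Rightarrow> 'a list set" where
  "cox_elt S m u = {v. cox_equiv S m u v}"

definition cox_group :: "'a set \<Rightarrow> ('a \<Rightarrow> 'a \<Rightarrow> nat) \<Rightarrow> 'a list set monoid" where
  "cox_group S m =
     \<lparr>carrier = cox_elt S m ` lists S,
      mult = (\<lambda>x y. \<Union>u\<in>x. \<Union>v\<in>y. cox_elt S m (u @ v)),
      one = cox_elt S m []\<rparr>"

lemma cox_equiv_lists: "cox_equiv S m u v \<Longrightarrow> u \<in> lists S \<and> v \<in> lists S"
proof (induction rule: cox_equiv.induct)
  case (relator u v s t)
  have "concat (replicate k [s, t]) \<in> lists S" for k
    by (induction k) (use relator in auto)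
  then show ?case using relator by auto
qed auto

lemma cox_equiv_context:
  "\<lbrakk>cox_equiv S m u v; a \<in> lists S; b \<in> lists S\<rbrakk> \<Longrightarrow> cox_equiv S m (a @ u @ b) (a @ v @ b)"
proof (induction rule: cox_equiv.induct)
  case (relator u v s t)
  then show ?case
    using cox_equiv.relator[of "a @ u" S "v @ b" s t m] by simp
next
  case (refl u)
  then show ?case by (intro cox_equiv.refl) auto
next
  case (sym u v)
  then show ?case by (blast intro: cox_equiv.sym)
next
  case (trans u v w)
  then show ?case by (blast intro: cox_equiv.trans)
qed

lemma cox_equiv_append:
  assumes "cox_equiv S m u u'" "cox_equiv S m v v'"
  shows "cox_equiv S m (u @ v) (u' @ v')"
proof -
  have l: "u \<in> lists S" "u' \<in> lists S" "v \<in> lists S" "v' \<in> lists S"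
    using assms cox_equiv_lists by blast+
  have "cox_equiv S m (u @ v) (u' @ v)"
    using cox_equiv_context[OF assms(1), of "[]" v] l by simp
  moreover have "cox_equiv S m (u' @ v) (u' @ v')"
    using cox_equiv_context[OF assms(2), of u' "[]"] l by simp
  ultimately show ?thesis by (rule cox_equiv.trans)
qed

lemma cox_elt_eq_iff:
  "u \<in> lists S \<Longrightarrow> cox_elt S m u = cox_elt S m v \<longleftrightarrow> cox_equiv S m u v"
proof
  assume u: "u \<in> lists S" and "cox_elt S m u = cox_elt S m v"
  then have "cox_equiv S m v u"
    using cox_equiv.refl[OF u, of m] unfolding cox_elt_def by blast
  then show "cox_equiv S m u v" by (rule cox_equiv.sym)
next
  assume "cox_equiv S m u v"
  then show "cox_elt S m u = cox_elt S m v"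
    unfolding cox_elt_def by (blast intro: cox_equiv.sym cox_equiv.trans)
qed

lemma cox_group_mult:
  assumes "u \<in> lists S" "v \<in> lists S"
  shows "cox_elt S m u \<otimes>\<^bsub>cox_group S m\<^esub> cox_elt S m v = cox_elt S m (u @ v)"
proof -
  have "cox_elt S m (u' @ v') = cox_elt S m (u @ v)"
    if "u' \<in> cox_elt S m u" "v' \<in> cox_elt S m v" for u' v'
  proof -
    have "cox_equiv S m (u @ v) (u' @ v')"
      using that cox_equiv_append unfolding cox_elt_def by blast
    then show ?thesis using assms by (subst eq_commute) (simp add: cox_elt_eq_iff)
  qed
  then have "(\<Union>u'\<in>cox_elt S m u. \<Union>v'\<in>cox_elt S m v. cox_elt S m (u' @ v'))
    = (\<Union>u'\<in>cox_elt S m u. \<Union>v'\<in>cox_elt S m v. cox_elt S m (u @ v))"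
    by (intro SUP_cong HOL.refl)
  moreover have "cox_elt S m u \<noteq> {}" "cox_elt S m v \<noteq> {}"
    using cox_equiv.refl[OF assms(1), of m] cox_equiv.refl[OF assms(2), of m]
    unfolding cox_elt_def by blast+
  ultimately show ?thesis by (simp add: cox_group_def)
qed

lemma cox_equiv_rev_append:
  assumes "\<And>s. s \<in> S \<Longrightarrow> m s s = 1" and "u \<in> lists S"
  shows "cox_equiv S m (rev u @ u) []"
  using assms(2)
proof (induction u)
  case Nil
  then show ?case by (simp add: cox_equiv.refl)
next
  case (Cons s u)
  then have "rev u \<in> lists S" by (auto simp: in_lists_conv_set)
  with Cons have "cox_equiv S m (rev u @ [s, s] @ u) (rev u @ u)"
    using cox_equiv.relator[of "rev u" S u s s m] assms(1)[of s] by simp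
  moreover have "cox_equiv S m (rev u @ u) []"
    using Cons by simp
  ultimately have "cox_equiv S m (rev u @ [s, s] @ u) []"
    by (rule cox_equiv.trans)
  then show ?case by simp
qed

lemma group_cox_group:
  assumes "\<And>s. s \<in> S \<Longrightarrow> m s s = 1"
  shows "group (cox_group S m)"
proof (rule groupI)
  have c: "carrier (cox_group S m) = cox_elt S m ` lists S"
    and o: "\<one>\<^bsub>cox_group S m\<^esub> = cox_elt S m []"
    by (simp_all add: cox_group_def)
  fix x assume "x \<in> carrier (cox_group S m)"
  then obtain u where u: "u \<in> lists S" "x = cox_elt S m u" unfolding c by blast
  show "\<one>\<^bsub>cox_group S m\<^esub> \<otimes>\<^bsub>cox_group S m\<^esub> x = x"
    using u by (simp add: o cox_group_mult)
  have "cox_elt S m (rev u) \<otimes>\<^bsub>cox_group S m\<^esub> x = \<one>\<^bsub>cox_group S m\<^esub>"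
    using u cox_equiv_rev_append[of S m u] assms
    by (simp add: o cox_group_mult in_lists_conv_set cox_elt_eq_iff)
  then show "\<exists>y\<in>carrier (cox_group S m). y \<otimes>\<^bsub>cox_group S m\<^esub> x = \<one>\<^bsub>cox_group S m\<^esub>"
    using u unfolding c by (auto simp: in_lists_conv_set)
next
  fix x y assume "x \<in> carrier (cox_group S m)" "y \<in> carrier (cox_group S m)"
  then show "x \<otimes>\<^bsub>cox_group S m\<^esub> y \<in> carrier (cox_group S m)"
    using cox_group_mult[of _ S _ m] by (force simp: cox_group_def)
next
  fix x y z
  assume "x \<in> carrier (cox_group S m)" "y \<in> carrier (cox_group S m)"
    "z \<in> carrier (cox_group S m)"
  then obtain u v w where "u \<in> lists S" "v \<in> lists S" "w \<in> lists S"
    "x = cox_elt S m u" "y = cox_elt S m v" "z = cox_elt S m w"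
    by (auto simp: cox_group_def)
  then show "x \<otimes>\<^bsub>cox_group S m\<^esub> y \<otimes>\<^bsub>cox_group S m\<^esub> z
    = x \<otimes>\<^bsub>cox_group S m\<^esub> (y \<otimes>\<^bsub>cox_group S m\<^esub> z)"
    by (simp add: cox_group_mult)
qed (auto simp: cox_group_def)

definition expressions :: "'a set \<Rightarrow> ('a \<Rightarrow> 'a \<Rightarrow> nat) \<Rightarrow> 'a list set \<Rightarrow> 'a list set" where
  "expressions S m w = {u \<in> lists S. cox_elt S m u = w}"

definition reduced_words :: "'a set \<Rightarrow> ('a \<Rightarrow> 'a \<Rightarrow> nat) \<Rightarrow> 'a list set \<Rightarrow> 'a list set" where
  "reduced_words S m w =
     {u \<in> expressions S m w. \<forall>v\<in>expressions S m w. length u \<le> length v}"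

text \<open>Distinct generators \<open>s\<close>, \<open>t\<close> are commuting generators when \<open>m s t = 2\<close>.\<close>

inductive commutation :: "('a \<Rightarrow> 'a \<Rightarrow> nat) \<Rightarrow> 'a list \<Rightarrow> 'a list \<Rightarrow> bool"
  for m :: "'a \<Rightarrow> 'a \<Rightarrow> nat" where
  "m s t = 2 \<Longrightarrow> commutation m (u @ [s, t] @ v) (u @ [t, s] @ v)"

definition fully_commutative :: "'a set \<Rightarrow> ('a \<Rightarrow> 'a \<Rightarrow> nat) \<Rightarrow> 'a list set \<Rightarrow> bool" where
  "fully_commutative S m w \<longleftrightarrow>
     (\<forall>u\<in>reduced_words S m w. \<forall>v\<in>reduced_words S m w. (commutation m)\<^sup>*\<^sup>* u v)"

definition cox_edges :: "'a set \<Rightarrow> ('a \<Rightarrow> 'a \<Rightarrow> nat) \<Rightarrow> 'a set set" where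
  "cox_edges S m = {{s, t} | s t. s \<in> S \<and> t \<in> S \<and> s \<noteq> t \<and> m s t \<noteq> 2}"


section \<open>Heaps\<close>

record ('b, 'a) labelled_poset =
  elems :: "'b set"
  le :: "'b rel"
  label :: "'b \<Rightarrow> 'a"

definition fibre :: "('b, 'a) labelled_poset \<Rightarrow> 'a set \<Rightarrow> 'b set" where
  "fibre H T = {x \<in> elems H. label H x \<in> T}"

text \<open>
  The relation whose transitive closure is taken is the union of the (reflexive) chains
  \<open>H\<^sub>s\<close> and \<open>H\<^sub>{\<^sub>s\<^sub>,\<^sub>t\<^sub>}\<close>, so it contains the diagonal.
\<close>

definition is_heap :: "'a set \<Rightarrow> 'a set set \<Rightarrow> ('b, 'a) labelled_poset \<Rightarrow> bool" where
  "is_heap S E H \<longleftrightarrow>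
     finite (elems H) \<and> partial_order_on (elems H) (le H) \<and> label H ` elems H \<subseteq> S \<and>
     (\<forall>s\<in>S. total_on (fibre H {s}) (le H)) \<and>
     (\<forall>e\<in>E. total_on (fibre H e) (le H)) \<and>
     le H = ((\<Union>s\<in>S. le H \<inter> fibre H {s} \<times> fibre H {s}) \<union>
             (\<Union>e\<in>E. le H \<inter> fibre H e \<times> fibre H e))\<^sup>+"

definition heap_iso :: "('b, 'a) labelled_poset \<Rightarrow> ('c, 'a) labelled_poset \<Rightarrow> bool" where
  "heap_iso H K \<longleftrightarrow>
     (\<exists>f. bij_betw f (elems H) (elems K) \<and>
          (\<forall>x\<in>elems H. \<forall>y\<in>elems H. (x, y) \<in> le H \<longleftrightarrow> (f x, f y) \<in> le K) \<and>
          (\<forall>x\<in>elems H. label K (f x) = label H x))"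

definition dual_heap :: "('b, 'a) labelled_poset \<Rightarrow> ('b, 'a) labelled_poset" where
  "dual_heap H = H\<lparr>le := (le H)\<inverse>\<rparr>"

definition self_dual :: "('b, 'a) labelled_poset \<Rightarrow> bool" where
  "self_dual H \<longleftrightarrow> heap_iso H (dual_heap H)"

text \<open>Positions of a word are numbered from \<open>0\<close>.\<close>

definition word_heap :: "'a set set \<Rightarrow> 'a list \<Rightarrow> (nat, 'a) labelled_poset" where
  "word_heap E u =
     \<lparr>elems = {..<length u},
      le = Id_on {..<length u} \<union>
           {(i, j). i < j \<and> j < length u \<and> (u ! i = u ! j \<or> {u ! i, u ! j} \<in> E)}\<^sup>+,
      label = (\<lambda>i. u ! i)\<rparr>"

text \<open>
  The heap of a fully commutative element is the heap of any of its reduced words; by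
  \<open>element_heap_iso\<close> below the choice does not matter up to isomorphism.
\<close>

definition element_heap ::
    "'a set \<Rightarrow> ('a \<Rightarrow> 'a \<Rightarrow> nat) \<Rightarrow> 'a list set \<Rightarrow> (nat, 'a) labelled_poset" where
  "element_heap S m w = word_heap (cox_edges S m) (SOME u. u \<in> reduced_words S m w)"

lemma heap_iso_refl: "heap_iso H H"
  unfolding heap_iso_def by (rule exI[of _ id]) auto

lemma heap_iso_trans:
  assumes "heap_iso H K" "heap_iso K L"
  shows "heap_iso H L"
proof -
  obtain f where f: "bij_betw f (elems H) (elems K)"
    "\<And>x y. x \<in> elems H \<Longrightarrow> y \<in> elems H \<Longrightarrow> (x, y) \<in> le H \<longleftrightarrow> (f x, f y) \<in> le K"
    "\<And>x. x \<in> elems H \<Longrightarrow> label K (f x) = label H x"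
    using assms(1) unfolding heap_iso_def by blast
  obtain g where g: "bij_betw g (elems K) (elems L)"
    "\<And>x y. x \<in> elems K \<Longrightarrow> y \<in> elems K \<Longrightarrow> (x, y) \<in> le K \<longleftrightarrow> (g x, g y) \<in> le L"
    "\<And>x. x \<in> elems K \<Longrightarrow> label L (g x) = label K x"
    using assms(2) unfolding heap_iso_def by blast
  have "f x \<in> elems K" if "x \<in> elems H" for x
    using f(1) that by (auto dest: bij_betwE)
  then show ?thesis
    unfolding heap_iso_def using f g
    by (intro exI[of _ "g \<circ> f"]) (auto intro: bij_betw_trans)
qed

lemma cox_edges_iff:
  assumes "\<And>s t. m s t = m t s"
  shows "{s, t} \<in> cox_edges S m \<longleftrightarrow> s \<in> S \<and> t \<in> S \<and> s \<noteq> t \<and> m s t \<noteq> 2"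
  using assms unfolding cox_edges_def by (auto simp: doubleton_eq_iff)

lemma word_heap_swap:
  assumes ne: "s \<noteq> t" and E: "{s, t} \<notin> E"
  shows "heap_iso (word_heap E (u @ [s, t] @ v)) (word_heap E (u @ [t, s] @ v))"
proof -
  let ?k = "length u" and ?l = "length u + length v + 2"
  let ?a = "u @ [s, t] @ v" and ?b = "u @ [t, s] @ v"
  define f where "f = id(?k := Suc ?k, Suc ?k := ?k)"
  define R where "R a = {(i, j). i < j \<and> j < length a \<and> (a ! i = a ! j \<or> {a ! i, a ! j} \<in> E)}"
    for a :: "'a list"
  have ff: "f (f i) = i" for i by (auto simp: f_def)
  have lt: "f i < ?l \<longleftrightarrow> i < ?l" for i by (auto simp: f_def)
  have lab: "?b ! f i = ?a ! i" for i
    by (auto simp: f_def nth_append nth_Cons' split: if_splits)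
  have lab': "?a ! f i = ?b ! i" for i using lab[of "f i"] by (simp add: ff)
  have nth: "?a ! ?k = s" "?a ! Suc ?k = t" "?b ! ?k = t" "?b ! Suc ?k = s"
    by (auto simp: nth_append)
  have mono: "f i < f j" if "i < j" "\<not> (i = ?k \<and> j = Suc ?k)" for i j
    using that by (auto simp: f_def)
  have edge: "(f i, f j) \<in> R ?b" if "(i, j) \<in> R ?a" for i j
  proof -
    have "\<not> (i = ?k \<and> j = Suc ?k)" using that nth ne E by (auto simp: R_def)
    then show ?thesis using that mono[of i j] lt[of j] lab[of i] lab[of j]
      unfolding R_def by auto
  qed
  have edge': "(f i, f j) \<in> R ?a" if "(i, j) \<in> R ?b" for i j
  proof -
    have "\<not> (i = ?k \<and> j = Suc ?k)" using that nth ne E by (auto simp: R_def insert_commute)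
    then show ?thesis using that mono[of i j] lt[of j] lab'[of i] lab'[of j]
      unfolding R_def by auto
  qed
  have tr: "(f i, f j) \<in> (R ?b)\<^sup>+" if "(i, j) \<in> (R ?a)\<^sup>+" for i j
    using that
  proof (induction rule: trancl_induct)
    case (base y)
    then show ?case by (rule trancl.intros(1)[OF edge])
  next
    case (step y z)
    then show ?case using edge by (blast intro: trancl.intros(2))
  qed
  have tr': "(f i, f j) \<in> (R ?a)\<^sup>+" if "(i, j) \<in> (R ?b)\<^sup>+" for i j
    using that
  proof (induction rule: trancl_induct)
    case (base y)
    then show ?case by (rule trancl.intros(1)[OF edge'])
  next
    case (step y z)
    then show ?case using edge' by (blast intro: trancl.intros(2))
  qed
  have iff: "(f i, f j) \<in> (R ?b)\<^sup>+ \<longleftrightarrow> (i, j) \<in> (R ?a)\<^sup>+" for i j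
    using tr[of i j] tr'[of "f i" "f j"] by (auto simp: ff)
  have wa: "word_heap E ?a = \<lparr>elems = {..<?l}, le = Id_on {..<?l} \<union> (R ?a)\<^sup>+, label = (!) ?a\<rparr>"
    and wb: "word_heap E ?b = \<lparr>elems = {..<?l}, le = Id_on {..<?l} \<union> (R ?b)\<^sup>+, label = (!) ?b\<rparr>"
    unfolding word_heap_def R_def by simp_all
  have inj: "f i = f j \<longleftrightarrow> i = j" for i j by (metis ff)
  have bij: "bij_betw f {..<?l} {..<?l}"
    by (rule bij_betw_byWitness[of _ f]) (use lt in \<open>auto simp: ff\<close>)
  show ?thesis
    unfolding heap_iso_def wa wb
    by (rule exI[of _ f]) (use bij iff lab lt inj in \<open>auto simp: Id_on_iff\<close>)
qed

lemma word_heap_commutation: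
  assumes "\<And>s t. m s t = m t s" "\<And>s. m s s = 1" "(commutation m)\<^sup>*\<^sup>* u v"
  shows "heap_iso (word_heap (cox_edges S m) u) (word_heap (cox_edges S m) v)"
  using assms(3)
proof (induction rule: rtranclp_induct)
  case base
  show ?case by (rule heap_iso_refl)
next
  case (step v w)
  have "heap_iso (word_heap (cox_edges S m) v) (word_heap (cox_edges S m) w)"
    using step(2)
  proof cases
    case (1 s t a b)
    then have "s \<noteq> t" using assms(2) by auto
    moreover have "{s, t} \<notin> cox_edges S m"
      using 1 assms(1) by (subst cox_edges_iff) auto
    ultimately show ?thesis using word_heap_swap 1 by metis
  qed
  with step.IH show ?case by (rule heap_iso_trans)
qed

lemma element_heap_iso:
  assumes "\<And>s t. m s t = m t s" "\<And>s. m s s = 1"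
    and "fully_commutative S m w" "u \<in> reduced_words S m w"
  shows "heap_iso (element_heap S m w) (word_heap (cox_edges S m) u)"
proof -
  have "(SOME u. u \<in> reduced_words S m w) \<in> reduced_words S m w"
    using assms(4) by (rule someI)
  then show ?thesis
    unfolding element_heap_def using assms
    by (intro word_heap_commutation) (auto simp: fully_commutative_def)
qed


section \<open>Type affine A\<close>

definition cycle_edges :: "nat \<Rightarrow> nat set set" where
  "cycle_edges n = {{i, Suc i mod n} | i. i < n}"

definition affA_matrix :: "nat \<Rightarrow> nat \<Rightarrow> nat \<Rightarrow> nat" where
  "affA_matrix n i j = (if i = j then 1 else if {i, j} \<in> cycle_edges n then 3 else 2)"

text \<open>For \<open>n \<ge> 3\<close>, \<open>affA n\<close> is the group with \<open>n\<close> generators and the \<open>n\<close>-cycle as Coxeter graph.\<close>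

definition affA :: "nat \<Rightarrow> nat list set monoid" where
  "affA n = cox_group {..<n} (affA_matrix n)"

lemma group_affA: "group (affA n)"
  unfolding affA_def by (rule group_cox_group) (simp add: affA_matrix_def)

lemma cox_edges_affA:
  assumes "n \<ge> 2"
  shows "cox_edges {..<n} (affA_matrix n) = cycle_edges n"
proof -
  have "Suc i mod n \<noteq> i \<and> Suc i mod n < n" if "i < n" for i
    using that assms by (auto simp: mod_Suc)
  then have *: "\<exists>s t. e = {s, t} \<and> s < n \<and> t < n \<and> s \<noteq> t" if "e \<in> cycle_edges n" for e
    using that unfolding cycle_edges_def by fastforce
  show ?thesis
    using * by (fastforce simp: cox_edges_def affA_matrix_def split: if_splits)
qed

text \<open>
  The labels along a chain alternate when elements that are consecutive in the chain have
  different labels.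
\<close>

definition alternating_on :: "('b, 'a) labelled_poset \<Rightarrow> 'b set \<Rightarrow> bool" where
  "alternating_on H C \<longleftrightarrow>
     (\<forall>x\<in>C. \<forall>y\<in>C. x \<noteq> y \<and> (x, y) \<in> le H \<and>
        \<not> (\<exists>z\<in>C. z \<noteq> x \<and> z \<noteq> y \<and> (x, z) \<in> le H \<and> (z, y) \<in> le H)
        \<longrightarrow> label H x \<noteq> label H y)"

definition alternating_affA_heap :: "nat \<Rightarrow> ('b, nat) labelled_poset \<Rightarrow> bool" where
  "alternating_affA_heap n H \<longleftrightarrow>
     is_heap {..<n} (cycle_edges n) H \<and> (\<forall>e\<in>cycle_edges n. alternating_on H (fibre H e))"

end

theory Submission
  imports Defs
begin

text \<open>
  Reversing a word turns its heap into the dual heap, and two words with isomorphic heaps have the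
  same projection to any two non-commuting letters, hence are commutation equivalent.  So
  \<open>w = w\<inverse>\<close> amounts to self-duality of the heap.  Alternation holds for every fully commutative
  element: between two consecutive occurrences of \<open>a\<close> in a reduced word there are at least two
  letters adjacent to \<open>a\<close>, as otherwise a deletion or a braid move would apply.  If one of the two
  neighbours of \<open>a\<close> were absent there, the other one would occur twice with no \<open>a\<close> in between; going
  round the cycle in this way one reaches the absent neighbour, a contradiction.
\<close>

section \<open>Coxeter words\<close>

lemma cox_equiv_rev_if_append_Nil:
  assumes "\<And>s. s \<in> S \<Longrightarrow> m s s = 1" "p \<in> lists S" "q \<in> lists S"
    and "cox_equiv S m (p @ q) []"
  shows "cox_equiv S m p (rev q)"
proof -
  have q: "rev q \<in> lists S" using assms(3) by (auto simp: in_lists_conv_set)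
  have "cox_equiv S m (p @ (q @ rev q) @ []) (p @ [] @ [])"
    using cox_equiv_rev_append[of S m "rev q"] assms(1,2) q by (intro cox_equiv_context) auto
  moreover have "cox_equiv S m ([] @ (p @ q) @ rev q) ([] @ [] @ rev q)"
    using assms(4) q by (intro cox_equiv_context) auto
  ultimately show ?thesis by (auto intro: cox_equiv.trans cox_equiv.sym)
qed

text \<open>Reading the second part of a relator backwards inverts it, since the generators are
  involutions. Cutting \<open>(s t)^m\<close> in the middle yields the commutation relation when
  \<open>m s t = 2\<close> and the braid relation when \<open>m s t = 3\<close>.\<close>

lemma cox_equiv_half_relator:
  assumes "\<And>s. s \<in> S \<Longrightarrow> m s s = 1" "s \<in> S" "t \<in> S"
    and "concat (replicate (m s t) [s, t]) = p @ q"
  shows "cox_equiv S m p (rev q)"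
proof (rule cox_equiv_rev_if_append_Nil)
  show "cox_equiv S m (p @ q) []"
    using cox_equiv.relator[of "[]" S "[]" s t m] assms by simp
  then have "p @ q \<in> lists S" by (blast dest: cox_equiv_lists)
  then show "p \<in> lists S" "q \<in> lists S" by auto
qed (rule assms(1))

lemma commutation_imp_cox_equiv:
  assumes "\<And>s. s \<in> S \<Longrightarrow> m s s = 1" "commutation m u v" "u \<in> lists S"
  shows "cox_equiv S m u v"
  using assms(2)
proof cases
  case (1 s t x y)
  then have "cox_equiv S m [s, t] (rev [s, t])"
    using assms by (intro cox_equiv_half_relator[of S m s t]) (auto simp: numeral_2_eq_2)
  then show ?thesis
    using 1 assms(3) cox_equiv_context[of S m "[s, t]" "[t, s]" x y] by simp
qed

lemma commutations_imp_cox_equiv: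
  assumes "\<And>s. s \<in> S \<Longrightarrow> m s s = 1" "(commutation m)\<^sup>*\<^sup>* u v" "u \<in> lists S"
  shows "cox_equiv S m u v"
  using assms(2)
proof (induction rule: rtranclp_induct)
  case base
  show ?case using assms(3) by (rule cox_equiv.refl)
next
  case (step v w)
  then have "v \<in> lists S" by (blast dest: cox_equiv_lists)
  with step show ?case
    using commutation_imp_cox_equiv[of S m v w] assms(1) cox_equiv.trans by blast
qed

lemma commutations_count_list: "(commutation m)\<^sup>*\<^sup>* u v \<Longrightarrow> count_list u a = count_list v a"
  by (induction rule: rtranclp_induct) (auto elim!: commutation.cases)

lemma commutations_sym:
  assumes "\<And>s t. m s t = m t s"
  shows "(commutation m)\<^sup>*\<^sup>* u v \<Longrightarrow> (commutation m)\<^sup>*\<^sup>* v u"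
proof (induction rule: rtranclp_induct)
  case (step v w)
  from step(2) have "commutation m w v"
  proof cases
    case (1 s t x y)
    then show ?thesis using commutation.intros[of m t s x y] assms[of s t] by simp
  qed
  then show ?case using step.IH by (rule converse_rtranclp_into_rtranclp)
qed simp

lemma commutations_move:
  assumes "\<And>b. b \<in> set v \<Longrightarrow> m a b = 2"
  shows "(commutation m)\<^sup>*\<^sup>* (x @ a # v @ y) (x @ v @ a # y)"
  using assms
proof (induction v arbitrary: x)
  case (Cons b v)
  have "commutation m (x @ [a, b] @ v @ y) (x @ [b, a] @ v @ y)"
    using Cons.prems by (intro commutation.intros) simp
  moreover have "(commutation m)\<^sup>*\<^sup>* ((x @ [b]) @ a # v @ y) ((x @ [b]) @ v @ a # y)"
    using Cons by (intro Cons.IH) simp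
  ultimately show ?case by (simp add: converse_rtranclp_into_rtranclp)
qed simp

section \<open>Reduced words, squares, and gaps between equal letters\<close>

lemma reduced_words_cox_equiv:
  assumes "u \<in> reduced_words S m w" "cox_equiv S m u v" "length v \<le> length u"
  shows "v \<in> reduced_words S m w"
proof -
  have "cox_elt S m v = w"
    using assms cox_elt_eq_iff[of u S m v]
    by (auto simp: reduced_words_def expressions_def)
  then show ?thesis
    using assms(1,3) cox_equiv_lists[OF assms(2)]
    by (auto simp: reduced_words_def expressions_def dest: le_trans)
qed

lemma reduced_words_length_le:
  assumes "u \<in> reduced_words S m w" "cox_equiv S m u v"
  shows "length u \<le> length v"
  using assms cox_elt_eq_iff[of u S m v] cox_equiv_lists[OF assms(2)]
  by (auto simp: reduced_words_def expressions_def)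

lemma reduced_words_nonempty:
  assumes "w \<in> carrier (cox_group S m)"
  shows "reduced_words S m w \<noteq> {}"
proof -
  obtain u where "u \<in> expressions S m w"
    using assms by (auto simp: cox_group_def expressions_def)
  then have "arg_min length (\<lambda>u. u \<in> expressions S m w) \<in> reduced_words S m w"
    unfolding reduced_words_def by (auto intro: arg_min_natI arg_min_nat_le)
  then show ?thesis by blast
qed

text \<open>Turns the involution condition into a comparison of \<open>u\<close> with its inverse
  \<open>rev u\<close>; on the side of heaps, reversal will become duality.\<close>

lemma cox_group_square_eq_one_iff:
  assumes "\<And>s. s \<in> S \<Longrightarrow> m s s = 1" "u \<in> lists S"
  shows "cox_elt S m u \<otimes>\<^bsub>cox_group S m\<^esub> cox_elt S m u = \<one>\<^bsub>cox_group S m\<^esub>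
    \<longleftrightarrow> cox_equiv S m u (rev u)"
proof -
  have "cox_elt S m u \<otimes>\<^bsub>cox_group S m\<^esub> cox_elt S m u = \<one>\<^bsub>cox_group S m\<^esub>
      \<longleftrightarrow> cox_equiv S m (u @ u) []"
    using assms(2) by (simp add: cox_group_mult cox_elt_eq_iff) (simp add: cox_group_def cox_elt_eq_iff assms)
  also have "\<dots> \<longleftrightarrow> cox_equiv S m u (rev u)"
  proof
    assume "cox_equiv S m u (rev u)"
    then have "cox_equiv S m (u @ u) (rev u @ u)"
      using assms(2) by (intro cox_equiv_append cox_equiv.refl)
    then show "cox_equiv S m (u @ u) []"
      using cox_equiv_rev_append[of S m u] assms by (blast intro: cox_equiv.trans)
  qed (use assms in \<open>auto intro: cox_equiv_rev_if_append_Nil\<close>)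
  finally show ?thesis .
qed

text \<open>If no letter of \<open>v\<close> is adjacent to \<open>a\<close>, the two
  \<open>a\<close> can be brought together and cancelled, against reducedness. If there is a single
  such letter \<open>b\<close>, commutations produce the factor \<open>a b a\<close>, and the braid
  move gives another reduced word with one \<open>a\<close> fewer; as commutations preserve letter
  counts, this contradicts full commutativity.\<close>

lemma fully_commutative_gap:
  assumes sym: "\<And>s t. m s t = m t s" and diag: "\<And>s. m s s = 1"
    and m23: "\<And>s t. s \<noteq> t \<Longrightarrow> m s t = 2 \<or> m s t = 3"
    and fc: "fully_commutative S m w" and red: "u \<in> reduced_words S m w"
    and u: "u = x @ a # v @ a # y" and a: "a \<notin> set v"
  shows "2 \<le> length (filter (\<lambda>b. m a b = 3) v)"
proof (rule ccontr)
  assume "\<not> ?thesis"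
  then have l: "length (filter (\<lambda>b. m a b = 3) v) < 2" by simp
  have uS: "u \<in> lists S" using red by (auto simp: reduced_words_def expressions_def)
  have comm: "m a b = 2" if "b \<in> set v" "m a b \<noteq> 3" for b
    using m23[of a b] that a by auto
  show False
  proof (cases "filter (\<lambda>b. m a b = 3) v")
    case Nil
    then have "(commutation m)\<^sup>*\<^sup>* u (x @ v @ a # a # y)"
      unfolding u using comm by (intro commutations_move) (auto simp: filter_empty_conv)
    then have "cox_equiv S m u (x @ v @ a # a # y)"
      using commutations_imp_cox_equiv[OF _ _ uS] diag by blast
    moreover have "cox_equiv S m ((x @ v) @ [a, a] @ y) ((x @ v) @ y)"
      using cox_equiv.relator[of "x @ v" S y a a m] uS diag u by simp
    ultimately have "cox_equiv S m u (x @ v @ y)"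
      by (auto intro: cox_equiv.trans)
    from reduced_words_length_le[OF red this] show False by (simp add: u)
  next
    case (Cons b bs)
    with l have "filter (\<lambda>b. m a b = 3) v = [b]" by simp
    then obtain v1 v2 where v: "v = v1 @ b # v2"
      and v1: "\<And>c. c \<in> set v1 \<Longrightarrow> m a c \<noteq> 3" and b: "m a b = 3"
      and v2: "\<And>c. c \<in> set v2 \<Longrightarrow> m a c \<noteq> 3"
      by (fastforce simp: filter_eq_Cons_iff filter_empty_conv dest: HOL.sym)
    have S: "a \<in> S" "b \<in> S" "x \<in> lists S" "y \<in> lists S" "v1 \<in> lists S" "v2 \<in> lists S"
      using uS by (auto simp: u v)
    have ab: "a \<noteq> b" using b diag by auto
    have "(commutation m)\<^sup>*\<^sup>* (x @ a # v1 @ b # v2 @ a # y) (x @ v1 @ a # b # v2 @ a # y)"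
      using v1 comm by (intro commutations_move) (auto simp: v)
    \<comment> \<open>The right-hand \<open>a\<close> moves left past \<open>v2\<close>, which is
      \<open>commutations_move\<close> read backwards.\<close>
    moreover have "(commutation m)\<^sup>*\<^sup>* ((x @ v1 @ [a, b]) @ v2 @ a # y) ((x @ v1 @ [a, b]) @ a # v2 @ y)"
      by (rule commutations_sym[OF sym], rule commutations_move) (use v2 comm v in auto)
    ultimately have "(commutation m)\<^sup>*\<^sup>* u (x @ v1 @ [a, b, a] @ v2 @ y)"
      by (simp add: u v)
    then have "cox_equiv S m u ((x @ v1) @ [a, b, a] @ (v2 @ y))"
      using commutations_imp_cox_equiv[OF _ _ uS] diag by simp
    moreover have "cox_equiv S m [a, b, a] (rev [b, a, b])"
      using diag S b by (intro cox_equiv_half_relator[of S m a b]) (auto simp: numeral_3_eq_3)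
    then have "cox_equiv S m ((x @ v1) @ [a, b, a] @ (v2 @ y)) ((x @ v1) @ [b, a, b] @ (v2 @ y))"
      using S cox_equiv_context[of S m "[a,b,a]" "[b,a,b]" "x @ v1" "v2 @ y"] by simp
    ultimately have e: "cox_equiv S m u ((x @ v1) @ [b, a, b] @ (v2 @ y))"
      by (rule cox_equiv.trans)
    have "(x @ v1) @ [b, a, b] @ (v2 @ y) \<in> reduced_words S m w"
      by (rule reduced_words_cox_equiv[OF red e]) (simp add: u v)
    then have "(commutation m)\<^sup>*\<^sup>* u ((x @ v1) @ [b, a, b] @ (v2 @ y))"
      using fc red by (auto simp: fully_commutative_def)
    from commutations_count_list[OF this, of a] show False using ab by (simp add: u v)
  qed
qed

section \<open>Going round the cycle\<close>

lemma filter_two_split: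
  assumes "2 \<le> length (filter P v)" "\<And>b. b \<in> set v \<Longrightarrow> P b \<Longrightarrow> b = c"
  obtains p v' q where "v = p @ c # v' @ c # q" "c \<notin> set v'"
proof -
  obtain b1 b2 bs where f: "filter P v = b1 # b2 # bs"
    using assms(1) by (cases "filter P v"; cases "tl (filter P v)") auto
  then obtain p v1 where v1: "v = p @ b1 # v1" "P b1" "filter P v1 = b2 # bs"
    by (metis filter_eq_Cons_iff)
  then have "b2 \<in> set v1" "P b2"
    by (metis list.set_intros(1) mem_Collect_eq set_filter)+
  then have "b1 = c" "c \<in> set v1" using v1 assms(2) by auto
  then show thesis
    using v1(1) that by (metis split_list_first)
qed

text \<open>\<open>f\<close> and \<open>g\<close> stand for the two rotations of the cycle; with
  both left abstract, one proof serves for either direction. Assumption \<open>fg\<close> says that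
  walking away from \<open>g a\<close> finally reaches it from the other side.\<close>

lemma neighbour_between:
  assumes gap: "\<And>x a v y. u = x @ a # v @ a # y \<Longrightarrow> a \<notin> set v \<Longrightarrow> 2 \<le> length (filter (N a) v)"
    and N: "\<And>a b. a \<in> set u \<Longrightarrow> N a b \<Longrightarrow> b = f a \<or> b = g a"
    and gf: "\<And>a. a \<in> set u \<Longrightarrow> g (f a) = a"
    and u: "u = x @ a # v @ a # y" and fg: "(f ^^ Suc k) a = g a"
  shows "g a \<in> set v"
proof (rule ccontr)
  assume g: "g a \<notin> set v"
  \<comment> \<open>A gap between two \<open>b\<close> that avoids \<open>b\<close> and
    \<open>g b\<close> contains \<open>f b\<close> at least twice, and the gap between these two
    avoids \<open>g (f b) = b\<close>. So the situation recurs one step further along the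
    cycle.\<close>
  have step: "\<exists>p v' q. v = p @ f b # v' @ f b # q \<and> f b \<notin> set v' \<and> g (f b) \<notin> set v'"
    if u: "u = x @ b # v @ b # y" and bv: "b \<notin> set v" "g b \<notin> set v" for x b v y
  proof -
    have b: "b \<in> set u" using u by simp
    obtain p v' q where "v = p @ f b # v' @ f b # q" "f b \<notin> set v'"
      by (rule filter_two_split[OF gap[OF u bv(1)], of "f b"]) (use N[OF b] bv in auto)
    moreover have "g (f b) \<notin> set v'" using gf[OF b] bv calculation by simp
    ultimately show ?thesis by blast
  qed
  \<comment> \<open>\<open>v\<close> may itself contain \<open>a\<close>, whereas
    \<open>step\<close> wants consecutive occurrences; the gap is therefore cut at the next
    \<open>a\<close>.\<close>
  obtain v0 y0 where v0: "u = x @ a # v0 @ a # y0" "a \<notin> set v0" "set v0 \<subseteq> set v"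
  proof (cases "a \<in> set v")
    case True
    then obtain v1 v2 where "v = v1 @ a # v2" "a \<notin> set v1" by (meson split_list_first)
    then show thesis using u by (intro that[of v1 "v2 @ a # y"]) auto
  qed (use u that in auto)
  \<comment> \<open>The gaps are nested, so every \<open>(f ^^ Suc j) a\<close> lies inside
    \<open>v0\<close>; the case \<open>j = k\<close> places \<open>g a\<close> there.\<close>
  have "\<exists>p v' q. v0 = p @ (f ^^ Suc j) a # v' @ (f ^^ Suc j) a # q \<and>
      (f ^^ Suc j) a \<notin> set v' \<and> g ((f ^^ Suc j) a) \<notin> set v'" for j
  proof (induction j)
    case 0
    then show ?case using step[OF v0(1,2)] v0(3) g by auto
  next
    case (Suc j)
    then obtain p v' q where *: "v0 = p @ (f ^^ Suc j) a # v' @ (f ^^ Suc j) a # q"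
      "(f ^^ Suc j) a \<notin> set v'" "g ((f ^^ Suc j) a) \<notin> set v'" by blast
    then have "u = (x @ a # p) @ (f ^^ Suc j) a # v' @ (f ^^ Suc j) a # (q @ a # y0)"
      using v0(1) by simp
    from step[OF this *(2,3)] obtain p' v'' q' where
      "v' = p' @ f ((f ^^ Suc j) a) # v'' @ f ((f ^^ Suc j) a) # q'"
      "f ((f ^^ Suc j) a) \<notin> set v''" "g (f ((f ^^ Suc j) a)) \<notin> set v''" by blast
    then show ?case using *(1)
      by (intro exI[of _ "p @ (f ^^ Suc j) a # p'"] exI[of _ v''] exI[of _ "q' @ (f ^^ Suc j) a # q"]) simp
  qed
  from this[of k] have "g a \<in> set v0" unfolding fg by auto
  with v0(3) g show False by blast
qed

section \<open>Heaps of words\<close>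

lemma elems_word_heap [simp]: "elems (word_heap E u) = {..<length u}"
  and label_word_heap [simp]: "label (word_heap E u) = (!) u"
  by (auto simp: word_heap_def)

lemma word_heap_le_imp_le:
  assumes "(i, j) \<in> le (word_heap E u)"
  shows "i \<le> j \<and> j < length u"
proof -
  have "i < j \<and> j < length u"
    if "(i, j) \<in> {(i, j). i < j \<and> j < length u \<and> (u ! i = u ! j \<or> {u ! i, u ! j} \<in> E)}\<^sup>+"
    using that by (induction rule: trancl_induct) auto
  then show ?thesis using assms by (auto simp: word_heap_def)
qed

lemma word_heap_leI:
  assumes "i \<le> j" "j < length u" "u ! i = u ! j \<or> {u ! i, u ! j} \<in> E"
  shows "(i, j) \<in> le (word_heap E u)"
  using assms by (cases "i = j") (auto simp: word_heap_def intro!: r_into_trancl)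

lemma trans_word_heap: "trans (le (word_heap E u))"
proof -
  define R where "R = {(i, j). i < j \<and> j < length u \<and> (u ! i = u ! j \<or> {u ! i, u ! j} \<in> E)}"
  have "le (word_heap E u) = Id_on {..<length u} \<union> R\<^sup>+" by (simp add: word_heap_def R_def)
  then show ?thesis by (auto simp: trans_def intro: trancl_trans)
qed

lemma is_heap_word_heap:
  assumes "u \<in> lists S" "\<And>e. e \<in> E \<Longrightarrow> \<exists>s t. e = {s, t}"
  shows "is_heap S E (word_heap E u)"
proof -
  let ?H = "word_heap E u"
  define R where "R = {(i, j). i < j \<and> j < length u \<and> (u ! i = u ! j \<or> {u ! i, u ! j} \<in> E)}"
  define U where "U = (\<Union>s\<in>S. le ?H \<inter> fibre ?H {s} \<times> fibre ?H {s}) \<union>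
             (\<Union>e\<in>E. le ?H \<inter> fibre ?H e \<times> fibre ?H e)"
  have leR: "le ?H = Id_on {..<length u} \<union> R\<^sup>+" by (simp add: word_heap_def R_def)
  have S: "u ! i \<in> S" if "i < length u" for i using assms(1) that by (auto simp: in_lists_conv_set)
  have po: "partial_order_on (elems ?H) (le ?H)"
    unfolding partial_order_on_def preorder_on_def
  proof (intro conjI)
    show "le ?H \<subseteq> elems ?H \<times> elems ?H"
      using word_heap_le_imp_le[of _ _ E u] by fastforce
    show "antisym (le ?H)"
      using word_heap_le_imp_le[of _ _ E u] by (meson antisymI le_antisym)
  qed (auto simp: trans_word_heap refl_on_def intro: word_heap_leI)
  \<comment> \<open>Allowing any \<open>T\<close> whose labels are pairwise equal or adjacent treats
    single vertices and edges at once.\<close>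
  have tot: "total_on (fibre ?H T) (le ?H)"
    if "\<And>s t. s \<in> T \<Longrightarrow> t \<in> T \<Longrightarrow> s = t \<or> {s, t} \<in> E" for T
    unfolding total_on_def
  proof (intro ballI impI)
    fix i j assume ij: "i \<in> fibre ?H T" "j \<in> fibre ?H T"
    show "(i, j) \<in> le ?H \<or> (j, i) \<in> le ?H"
      using that[of "u ! i" "u ! j"] that[of "u ! j" "u ! i"] ij
        word_heap_leI[of i j u E] word_heap_leI[of j i u E]
      by (cases "i \<le> j") (auto simp: fibre_def)
  qed
  have "(i, j) \<in> U" if "i < length u" "j < length u" "(i, j) \<in> le ?H"
    "u ! i = u ! j \<or> {u ! i, u ! j} \<in> E" for i j
    using that(4)
  proof
    assume "u ! i = u ! j"
    then show ?thesis unfolding U_def using that(1-3) S[of i]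
      by (intro UnI1 UN_I[of "u ! i"]) (simp_all add: fibre_def)
  next
    assume "{u ! i, u ! j} \<in> E"
    then show ?thesis unfolding U_def using that(1-3)
      by (intro UnI2 UN_I[of "{u ! i, u ! j}"]) (simp_all add: fibre_def)
  qed
  then have "Id_on {..<length u} \<subseteq> U" "R \<subseteq> U"
    using word_heap_leI[of _ _ u E] by (auto simp: R_def)
  then have "le ?H \<subseteq> U\<^sup>+" unfolding leR by (auto intro: trancl_mono)
  \<comment> \<open>The chains are parts of the order, which is already transitive, so closing them
    up leads no further.\<close>
  moreover have "U\<^sup>+ \<subseteq> (le ?H)\<^sup>+" by (rule trancl_mono_subset) (auto simp: U_def)
  ultimately have "le ?H = U\<^sup>+" using trancl_id[OF trans_word_heap[of E u]] by blast
  moreover have "total_on (fibre ?H e) (le ?H)" if "e \<in> E" for e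
    using assms(2)[OF that] that by (intro tot) (auto simp: insert_commute)
  ultimately show ?thesis
    unfolding is_heap_def U_def[symmetric] using po S tot[of "{_}"] by auto
qed

section \<open>Duality, and recovery of a word from its heap\<close>

lemma dual_dual_heap [simp]: "dual_heap (dual_heap H) = H"
  by (simp add: dual_heap_def)

lemma heap_iso_dual:
  assumes "heap_iso H K"
  shows "heap_iso (dual_heap H) (dual_heap K)"
proof -
  obtain f where "bij_betw f (elems H) (elems K)"
    "\<forall>x\<in>elems H. \<forall>y\<in>elems H. (x, y) \<in> le H \<longleftrightarrow> (f x, f y) \<in> le K"
    "\<forall>x\<in>elems H. label K (f x) = label H x"
    using assms unfolding heap_iso_def by blast
  then show ?thesis
    unfolding heap_iso_def dual_heap_def by (intro exI[of _ f]) simp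
qed

text \<open>The isomorphism is the reflection of positions \<open>i -> length u - 1 - i\<close>: it
  reverses \<open>i < j\<close> and carries the letters of \<open>rev u\<close> to those of
  \<open>u\<close>, while the condition on labels is symmetric.\<close>

lemma word_heap_rev: "heap_iso (word_heap E (rev u)) (dual_heap (word_heap E u))"
proof -
  define R where "R a = {(i, j). i < j \<and> j < length a \<and> (a ! i = a ! j \<or> {a ! i, a ! j} \<in> E)}"
    for a :: "'a list"
  define f where "f i = length u - Suc i" for i
  \<comment> \<open>\<open>a\<close> is left open so that the fact serves for \<open>u\<close> and
    for \<open>rev u\<close>; as the reflection is its own inverse, this gives both implications of
    \<open>iff\<close>.\<close>
  have edge: "(f j, f i) \<in> R a" if "(i, j) \<in> R (rev a)" "length a = length u" for i j a
    using that by (auto simp: R_def f_def rev_nth insert_commute)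
  have tr: "(f j, f i) \<in> (R a)\<^sup>+" if "(i, j) \<in> (R (rev a))\<^sup>+" "length a = length u" for i j a
    using that(1)
  proof (induction rule: trancl_induct)
    case (base y)
    then show ?case using edge that(2) by blast
  next
    case (step y z)
    then show ?case using edge[of y z a] that(2) by (meson trancl_into_trancl2)
  qed
  have ff: "f (f i) = i" if "i < length u" for i using that by (auto simp: f_def)
  have iff: "(i, j) \<in> (R (rev u))\<^sup>+ \<longleftrightarrow> (f j, f i) \<in> (R u)\<^sup>+" if "i < length u" "j < length u" for i j
    using tr[of i j u] tr[of "f j" "f i" "rev u"] that by (auto simp: ff)
  have bij: "bij_betw f {..<length u} {..<length u}"
    by (rule bij_betw_byWitness[of _ f]) (auto simp: f_def)
  then have inj: "f i = f j \<longleftrightarrow> i = j" if "i < length u" "j < length u" for i j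
    using that by (auto simp: bij_betw_def inj_on_def)
  have lt: "f i < length u" if "i < length u" for i using that by (auto simp: f_def)
  have le: "le (word_heap E a) = Id_on {..<length a} \<union> (R a)\<^sup>+" for a
    by (simp add: word_heap_def R_def)
  show ?thesis
    unfolding heap_iso_def dual_heap_def
    by (rule exI[of _ f]) (use bij iff inj lt in \<open>auto simp: le Id_on_iff f_def rev_nth\<close>)
qed

text \<open>In either word the positions labelled \<open>s\<close> or \<open>t\<close> form a chain,
  and an isomorphism can match two finite chains only in increasing order, so the letters read along
  them agree.\<close>

lemma heap_iso_word_heap_filter:
  assumes "heap_iso (word_heap E u) (word_heap E v)" and T: "s = t \<or> {s, t} \<in> E"
  shows "filter (\<lambda>c. c \<in> {s, t}) u = filter (\<lambda>c. c \<in> {s, t}) v"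
proof -
  obtain f where f: "bij_betw f {..<length u} {..<length v}"
    "\<And>i j. i < length u \<Longrightarrow> j < length u \<Longrightarrow>
      (i, j) \<in> le (word_heap E u) \<longleftrightarrow> (f i, f j) \<in> le (word_heap E v)"
    "\<And>i. i < length u \<Longrightarrow> v ! f i = u ! i"
    using assms(1) unfolding heap_iso_def by auto
  have ran: "f i < length v" if "i < length u" for i using f(1) that by (auto dest: bij_betwE)
  let ?P = "\<lambda>a i. a ! i \<in> {s, t}"
  let ?I = "filter (?P u) [0..<length u]" and ?J = "filter (?P v) [0..<length v]"
  have filt: "filter (\<lambda>c. c \<in> {s, t}) a = map ((!) a) (filter (?P a) [0..<length a])" for a
    by (metis (no_types, lifting) filter_cong filter_map comp_def map_nth)
  have mono: "f i \<le> f j" if "i \<in> set ?I" "j \<in> set ?I" "i \<le> j" for i j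
  proof -
    have "u ! i = u ! j \<or> {u ! i, u ! j} \<in> E" using that T by (auto simp: insert_commute)
    then have "(i, j) \<in> le (word_heap E u)" using that by (intro word_heap_leI) auto
    then show ?thesis using f(2)[of i j] that by (auto dest: word_heap_le_imp_le)
  qed
  \<comment> \<open>A strictly increasing list is determined by its set, so \<open>f\<close> carries
    the position list \<open>?I\<close> to \<open>?J\<close>.\<close>
  have s: "sorted (map f ?I)"
    unfolding sorted_map
    by (rule sorted_wrt_mono_rel[OF _ sorted_wrt_filter[OF sorted_upt]])
       (use mono in auto)
  have d: "distinct (map f ?I)"
    using f(1) by (auto simp: distinct_map bij_betw_def inj_on_def)
  have e: "set (map f ?I) = set ?J"
  proof
    show "set (map f ?I) \<subseteq> set ?J" using ran f(3) by auto
    show "set ?J \<subseteq> set (map f ?I)"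
    proof
      fix j assume j: "j \<in> set ?J"
      then obtain i where "i < length u" "j = f i" using f(1) by (auto simp: bij_betw_def)
      then show "j \<in> set (map f ?I)" using j f(3)[of i] by auto
    qed
  qed
  have J: "map f ?I = ?J"
    by (rule sorted_distinct_set_unique[OF s d sorted_wrt_filter[OF sorted_upt] _ e]) simp
  have "map ((!) v) (map f ?I) = map ((!) u) ?I" using f(3) by simp
  then show ?thesis by (simp only: filt J)
qed

text \<open>This is the projection lemma for trace monoids. All letters before the first occurrence
  in \<open>v\<close> of the leading letter of \<open>u\<close> commute with it, so that letter can
  be cancelled from both words while the projections stay equal.\<close>

lemma filters_eq_imp_commutations:
  assumes "\<And>s t. m s t = m t s" and m: "\<And>s t. s \<noteq> t \<Longrightarrow> m s t \<noteq> 2 \<Longrightarrow> s \<in> S \<Longrightarrow> t \<in> S \<Longrightarrow> {s, t} \<in> E"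
    and "u \<in> lists S" "v \<in> lists S"
    and "\<And>s t. s = t \<or> {s, t} \<in> E \<Longrightarrow> filter (\<lambda>c. c \<in> {s, t}) u = filter (\<lambda>c. c \<in> {s, t}) v"
  shows "(commutation m)\<^sup>*\<^sup>* u v"
  using assms(3-5)
proof (induction u arbitrary: v rule: list.induct)
  case Nil
  have "c \<notin> set v" for c using Nil.prems(3)[of c c, symmetric] by (auto simp: filter_empty_conv)
  then show ?case by (cases v) auto
next
  case (Cons a u)
  have "a \<in> set (filter (\<lambda>c. c \<in> {a, a}) v)"
    unfolding Cons.prems(3)[of a a, OF disjI1, OF HOL.refl, symmetric] by simp
  then obtain v1 v2 where v: "v = v1 @ a # v2" "a \<notin> set v1"
    by (auto dest: split_list_first)
  \<comment> \<open>The projection of \<open>a # u\<close> to \<open>{a, b}\<close> starts with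
    \<open>a\<close>, so no \<open>b\<close> can precede the first \<open>a\<close> of
    \<open>v\<close>.\<close>
  have avoid: "b \<notin> set v1" if "{a, b} \<in> E" for b
  proof
    assume b: "b \<in> set v1"
    have "a # filter (\<lambda>c. c \<in> {a, b}) u = filter (\<lambda>c. c \<in> {a, b}) v1 @ filter (\<lambda>c. c \<in> {a, b}) (a # v2)"
      using Cons.prems(3)[of a b] that by (simp add: v)
    moreover have "filter (\<lambda>c. c \<in> {a, b}) v1 \<noteq> []" using b by (auto simp: filter_empty_conv)
    ultimately have "a \<in> set (filter (\<lambda>c. c \<in> {a, b}) v1)"
      by (metis append_eq_Cons_conv list.set_intros(1))
    then show False using v by simp
  qed
  have comm: "m a b = 2" if "b \<in> set v1" for b
    using m[of a b] avoid[of b] that v Cons.prems(1,2) by auto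
  have "(commutation m)\<^sup>*\<^sup>* u (v1 @ v2)"
  proof (rule Cons.IH)
    fix s t :: 'a assume st: "s = t \<or> {s, t} \<in> E"
    show "filter (\<lambda>c. c \<in> {s, t}) u = filter (\<lambda>c. c \<in> {s, t}) (v1 @ v2)"
    proof (cases "a \<in> {s, t}")
      case False
      then show ?thesis using Cons.prems(3)[OF st] by (auto simp: v)
    next
      case True
      \<comment> \<open>Nothing of \<open>v1\<close> survives here, so both projections begin with
        the cancelled \<open>a\<close> and lose it together.\<close>
      have "filter (\<lambda>c. c \<in> {s, t}) v1 = []"
        using True st avoid v(2) by (auto simp: filter_empty_conv insert_commute)
      then show ?thesis using Cons.prems(3)[OF st] True by (simp add: v)
    qed
  qed (use Cons.prems v in auto)
  then have "(commutation m)\<^sup>*\<^sup>* (a # u) (a # v1 @ v2)"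
  proof (induction rule: rtranclp_induct)
    case (step y z)
    from step(2) have "commutation m (a # y) (a # z)"
    proof cases
      case (1 s t p q)
      then show ?thesis using commutation.intros[of m s t "a # p" q] by simp
    qed
    then show ?case using step.IH by (rule rtranclp.rtrancl_into_rtrancl[rotated])
  qed simp
  moreover have "(commutation m)\<^sup>*\<^sup>* ([] @ a # v1 @ v2) ([] @ v1 @ a # v2)"
    using comm by (rule commutations_move)
  ultimately show ?case by (simp add: v)
qed

lemma self_dual_word_heap_iff:
  "self_dual (word_heap E u) \<longleftrightarrow> heap_iso (word_heap E u) (word_heap E (rev u))"
proof -
  \<comment> \<open>Dualising the isomorphism for \<open>rev u\<close> supplies the arrow in the
    opposite direction.\<close>
  have "heap_iso (dual_heap (word_heap E u)) (word_heap E (rev u))"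
    using heap_iso_dual[OF word_heap_rev[of E "rev u"]] by simp
  then show ?thesis
    unfolding self_dual_def using word_heap_rev[of E u] by (blast intro: heap_iso_trans)
qed

section \<open>Type affine A\<close>

lemma affA_matrix_sym: "affA_matrix n s t = affA_matrix n t s"
  by (simp add: affA_matrix_def insert_commute)

lemma affA_matrix_diag: "affA_matrix n s s = 1"
  by (simp add: affA_matrix_def)

text \<open>The predecessor on the cycle is written as adding \<open>n - 1\<close>, because
  truncated subtraction would fix 0.\<close>

lemma Suc_mod_pred_mod: "c < n \<Longrightarrow> (Suc c mod n + (n - 1)) mod n = (c::nat)"
  by (cases "Suc c = n") auto

lemma cycle_edges_cases:
  assumes "{a, b} \<in> cycle_edges n" "a < n"
  shows "b = Suc a mod n \<or> b = (a + (n - 1)) mod n"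
proof -
  obtain i where i: "i < n" "{a, b} = {i, Suc i mod n}" using assms(1) by (auto simp: cycle_edges_def)
  have "i = (Suc i mod n + (n - 1)) mod n"
    using Suc_mod_pred_mod[OF i(1)] by simp
  then show ?thesis using i(2) by (auto simp: doubleton_eq_iff)
qed

text \<open>\<open>b\<close> is the successor or the predecessor of \<open>a\<close>. Both occur in
  \<open>v\<close>, by two uses of \<open>neighbour_between\<close> with the rotations
  exchanged.\<close>

lemma fully_commutative_affA_alternates:
  assumes "n \<ge> 3" "fully_commutative {..<n} (affA_matrix n) w"
    and red: "u \<in> reduced_words {..<n} (affA_matrix n) w"
    and u: "u = x @ a # v @ a # y" and ab: "{a, b} \<in> cycle_edges n"
  shows "b \<in> set v"
proof -
  have n: "c < n" if "c \<in> set u" for c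
    using red that by (auto simp: reduced_words_def expressions_def)
  define p where "p = n - 1"
  define f where "f c = (c + p) mod n" for c
  define g where "g c = Suc c mod n" for c
  have gap: "2 \<le> length (filter (\<lambda>b. affA_matrix n a b = 3) v)"
    if "u = x @ a # v @ a # y" "a \<notin> set v" for x a v y
    by (rule fully_commutative_gap[OF affA_matrix_sym affA_matrix_diag _ assms(2) red that])
       (auto simp: affA_matrix_def)
  have N: "b = f a \<or> b = g a" if "a \<in> set u" "affA_matrix n a b = 3" for a b
    using cycle_edges_cases[of a b n] that n by (auto simp: affA_matrix_def f_def g_def p_def split: if_splits)
  have gf: "g (f c) = c" and fg: "f (g c) = c" if "c \<in> set u" for c
    using n[OF that] Suc_mod_pred_mod[of c n] by (simp_all add: f_def g_def p_def mod_Suc_eq)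
  have fpow: "(f ^^ Suc k) c = (c + Suc k * p) mod n" for k c
    by (induction k) (simp_all add: f_def algebra_simps mod_simps)
  have gpow: "(g ^^ Suc k) c = (c + Suc k) mod n" for k c
    by (induction k) (auto simp: g_def mod_Suc_eq)
  obtain k where k: "n = k + 3" using assms(1) by (metis le_Suc_ex add.commute)
  \<comment> \<open>With \<open>p = n - 1 = k + 2\<close> this is
    \<open>(n - 1)^2 = (n - 2) n + 1\<close>: going back \<open>n - 1\<close> times is one step
    forward.\<close>
  have "a + Suc (Suc k) * p = Suc a + (k + 1) * n" by (simp add: k p_def algebra_simps)
  then have "(f ^^ Suc (Suc k)) a = g a" unfolding fpow g_def by (simp only: mod_mult_self1)
  then have "g a \<in> set v"
    by (rule neighbour_between[where N = "\<lambda>a b. affA_matrix n a b = 3", OF _ _ _ u, rotated -1])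
       (fact gap N gf)+
  moreover have N': "b = g a \<or> b = f a" if "a \<in> set u" "affA_matrix n a b = 3" for a b
    using N[OF that] by blast
  \<comment> \<open>Likewise \<open>n - 1\<close> steps forward are one step back.\<close>
  have "(g ^^ Suc (Suc k)) a = f a" unfolding gpow f_def by (simp add: k p_def)
  then have "f a \<in> set v"
    by (rule neighbour_between[where N = "\<lambda>a b. affA_matrix n a b = 3", OF _ _ _ u, rotated -1])
       (fact gap N' fg)+
  moreover have "b = g a \<or> b = f a"
    using cycle_edges_cases[OF ab] n u by (auto simp: f_def g_def p_def)
  ultimately show ?thesis by blast
qed

text \<open>Reduces alternation to a condition on factors of the word: a position with the other
  label of \<open>e\<close>, lying between two positions with equal labels, is comparable to both,
  so these are not consecutive in the chain.\<close>

lemma alternating_on_word_heap: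
  assumes "\<And>x a v y c. u = x @ a # v @ a # y \<Longrightarrow> {a, c} = e \<Longrightarrow> c \<in> set v"
    and e: "e = {s, t}" "e \<in> E"
  shows "alternating_on (word_heap E u) (fibre (word_heap E u) e)"
  unfolding alternating_on_def
proof (intro ballI impI notI, elim conjE)
  let ?H = "word_heap E u"
  fix i j assume i: "i \<in> fibre ?H e" and j: "j \<in> fibre ?H e" and ne: "i \<noteq> j" and le: "(i, j) \<in> le ?H"
    and no: "\<not> (\<exists>z\<in>fibre ?H e. z \<noteq> i \<and> z \<noteq> j \<and> (i, z) \<in> le ?H \<and> (z, j) \<in> le ?H)"
    and "label ?H i = label ?H j"
  then have eq: "u ! i = u ! j" by simp
  have ij: "i < j" "j < length u" using word_heap_le_imp_le[OF le] ne by auto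
  define v where "v = take (j - Suc i) (drop (Suc i) u)"
  have dj: "drop (Suc i) u = v @ drop j u"
    unfolding v_def using ij by (metis append_take_drop_id drop_drop le_add_diff_inverse2 Suc_leI)
  have "u = take i u @ u ! i # drop (Suc i) u" using ij by (simp add: id_take_nth_drop)
  moreover have "drop j u = u ! i # drop (Suc j) u" using ij eq by (simp add: Cons_nth_drop_Suc)
  ultimately have u: "u = take i u @ u ! i # v @ u ! i # drop (Suc j) u" using dj by simp
  obtain c where c: "{u ! i, c} = e" using i e by (auto simp: fibre_def)
  from assms(1)[OF u c] obtain k where k: "k < length v" "v ! k = c" by (auto simp: in_set_conv_nth)
  \<comment> \<open>\<open>v\<close> begins at position \<open>i + 1\<close> of \<open>u\<close>,
    hence the shift.\<close>
  let ?z = "Suc i + k"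
  have z: "?z < j" "u ! ?z = c" using k ij by (auto simp: v_def)
  have "(i, ?z) \<in> le ?H" "(?z, j) \<in> le ?H"
    using z ij c e eq by (auto intro!: word_heap_leI simp: insert_commute)
  moreover have "?z \<in> fibre ?H e" using z ij c by (auto simp: fibre_def)
  ultimately show False using no z by fastforce
qed

theorem proposition3p2:
  fixes n :: nat and w :: "nat list set"
  assumes "n \<ge> 3"
    and "w \<in> carrier (affA n)"
    and "fully_commutative {..<n} (affA_matrix n) w"
  shows "w \<otimes>\<^bsub>affA n\<^esub> w = \<one>\<^bsub>affA n\<^esub> \<longleftrightarrow>
         self_dual (element_heap {..<n} (affA_matrix n) w) \<and>
         alternating_affA_heap n (element_heap {..<n} (affA_matrix n) w)"
proof -
  let ?m = "affA_matrix n" and ?S = "{..<n}" and ?E = "cycle_edges n"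
  \<comment> \<open>This is the word chosen inside \<open>element_heap\<close>, so once
    \<open>cox_edges\<close> is identified with the cycle, the heap of the claim is literally
    \<open>word_heap ?E u\<close>.\<close>
  define u where "u = (SOME u. u \<in> reduced_words ?S ?m w)"
  have red: "u \<in> reduced_words ?S ?m w"
    unfolding u_def using reduced_words_nonempty assms(2) by (metis affA_def some_in_eq)
  then have uS: "u \<in> lists ?S" and w: "w = cox_elt ?S ?m u"
    by (auto simp: reduced_words_def expressions_def)
  then have rS: "rev u \<in> lists ?S" by (auto simp: in_lists_conv_set)
  have E: "cox_edges ?S ?m = ?E" using cox_edges_affA assms(1) by simp
  then have H: "element_heap ?S ?m w = word_heap ?E u" by (simp add: element_heap_def u_def)
  have "alternating_on (word_heap ?E u) (fibre (word_heap ?E u) e)" if "e \<in> ?E" for e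
  proof -
    from that obtain s t where "e = {s, t}" by (auto simp: cycle_edges_def)
    then show ?thesis
      using fully_commutative_affA_alternates[OF assms(1,3) red] that
      by (intro alternating_on_word_heap) auto
  qed
  moreover have "is_heap ?S ?E (word_heap ?E u)"
    using uS by (intro is_heap_word_heap) (auto simp: cycle_edges_def)
  ultimately have alt: "alternating_affA_heap n (word_heap ?E u)"
    by (simp add: alternating_affA_heap_def)
  have "w \<otimes>\<^bsub>affA n\<^esub> w = \<one>\<^bsub>affA n\<^esub> \<longleftrightarrow> cox_equiv ?S ?m u (rev u)"
    unfolding w affA_def by (intro cox_group_square_eq_one_iff uS) (rule affA_matrix_diag)
  \<comment> \<open>\<open>rev u\<close> is as long as \<open>u\<close>, so it is a reduced word of
    \<open>w\<close> once the two are equivalent, and full commutativity then turns the equivalence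
    into commutations.\<close>
  also have "\<dots> \<longleftrightarrow> (commutation ?m)\<^sup>*\<^sup>* u (rev u)"
    using assms(3) red reduced_words_cox_equiv[OF red, of "rev u"]
      commutations_imp_cox_equiv[of ?S ?m, OF affA_matrix_diag _ uS]
    by (auto simp: fully_commutative_def)
  \<comment> \<open>Commutations preserve the heap; conversely, isomorphic heaps have equal
    projections to vertices and edges, which determine a word up to commutations.\<close>
  also have "\<dots> \<longleftrightarrow> heap_iso (word_heap ?E u) (word_heap ?E (rev u))"
  proof
    assume "heap_iso (word_heap ?E u) (word_heap ?E (rev u))"
    then show "(commutation ?m)\<^sup>*\<^sup>* u (rev u)"
      by (intro filters_eq_imp_commutations[of ?m ?S ?E, OF affA_matrix_sym _ uS rS]
          heap_iso_word_heap_filter) (auto simp: affA_matrix_def split: if_splits)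
  qed (use word_heap_commutation[of ?m u "rev u" ?S, OF affA_matrix_sym affA_matrix_diag] E in simp)
  finally show ?thesis unfolding H self_dual_word_heap_iff using alt by simp
qed

end
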